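(* If $t_i^L<t_i^f<t_i^U$, then an optimal trajectory of CAV $i$ cannot enter the constrained arc $v_i(t)-v_{\max}=0$ directly from the constrained arc $u_i(t)-u_{\max}=0$; that is, there is no time $\tau$ such that $u_i^*(t)=u_{\max}$ and $v_i^*(t)<v_{\max}$ on an interval immediately to the left of $\tau$ and $v_i^*(t)=v_{\max}$ on an interval immediately to the right of $\tau$.
   Context: Problem. CAV $i$ travels a distance $L+S$ (a control zone of length $L$ followed by a merging zone of length $S$) with dynamics $\dot p_i=v_i$, $\dot v_i=u_i$, $p_i(t_i^0)=0$, $v_i(t_i^0)=v_i^0$ given, $p_i(t_i^f)=L+S$, and minimizes $\int_{t_i^0}^{t_i^f}\big[\gamma+\tfrac12u_i^2(t)\big]dt$, where $\gamma\ge0$ is a constant weight (the terminal time $t_i^f$ may be free or constrained). The constraints include $u_{\min}\le u_i(t)\le u_{\max}$ and $0\le v_{\min}\le v_i(t)\le v_{\max}$ on $[t_i^0,t_i^f]$; the speed constraints are not active at $t_i^0$. The case considered is the one in which the constraints that become active are $u_i(t)-u_{\max}\le0$ and $v_i(t)-v_{\max}\le0$; the remaining constraints of the problem (a rear-end safety constraint $p_k(t)-p_i(t)\ge\varphi v_i(t)+\delta_0$ with respect to the CAV $k$ ahead, a lateral constraint $p_i(t_1)\le L$ at a given time $t_1$, and the lower bounds on $u_i$ and $v_i$) are inactive. Terminal time bounds. Write $v_i^f=v_i(t_i^f)$. Then $t_i^L=t_i^1\mathbf{1}_{\{v_i^f=v_{\max}\}}+t_i^2(1-\mathbf{1}_{\{v_i^f=v_{\max}\}})$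 with $$t_i^1=t_i^0+\frac{L+S}{v_{\max}}+\frac{(v_{\max}-v_i^0)^2}{2u_{\max}v_{\max}},\qquad t_i^2=t_i^0+\frac{[2(L+S)u_{\max}+(v_i^0)^2]^{1/2}-v_i^0}{u_{\max}},$$ and $t_i^U=t_i^3\mathbf{1}_{\{v_i^f=v_{\min}\}}+t_i^4(1-\mathbf{1}_{\{v_i^f=v_{\min}\}})$ with $$t_i^3=t_i^0+\frac{L+S}{v_{\min}}+\frac{(v_{\min}-v_i^0)^2}{2u_{\min}v_{\min}},\qquad t_i^4=t_i^0+\frac{\sqrt{2(L+S)u_{\min}+(v_i^0)^2}-v_i^0}{u_{\min}}.$$ Necessary conditions satisfied by an optimal trajectory. The Hamiltonian is $H_i=\gamma+\tfrac12u_i^2+\lambda_i^pv_i+\lambda_i^vu_i$, with costates $\lambda_i^p,\lambda_i^v$. States are continuous, and the control, costates and multipliers have one-sided limits at junctions of arcs. - Stationarity: $u_i+\lambda_i^v+\mu_i^a-\mu_i^b=0$, where $\mu_i^a\ge0$ with $\mu_i^a=0$ if $u_i<u_{\max}$, and $\mu_i^b\ge0$ with $\mu_i^b=0$ if $u_i>u_{\min}$. In particular, on an arc $u_i=u_{\max}$ one has $u_i+\lambda_i^v+\mu_i^a=0$ with $\mu_i^a\ge0$. - On an arc $v_i=v_{\max}$, one has $u_i=\dot v_i=0$. - At a time $\tau$ where the trajectory enters the arc $v_i=v_{\max}$, there is a multiplier $\pi_i(\tau)\ge0$ with $\pi_i(\tau)(v_i(\tau)-v_{\max})=0$ such that $$\lambda_i^p(\tau^-)=\lambda_i^p(\tau^+),\qquad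 \lambda_i^v(\tau^-)=\lambda_i^v(\tau^+)+\pi_i(\tau),\qquad H_i(\tau^-)=H_i(\tau^+),$$ where $\tau^-$ and $\tau^+$ denote left and right limits. *)

theory Defs
  imports "HOL-Analysis.Analysis"
begin

record cav_problem =
  weight :: real               \<comment> \<open>\<open>\<gamma>\<close>\<close>
  control_len :: real          \<comment> \<open>\<open>L\<close>\<close>
  merge_len :: real            \<comment> \<open>\<open>S\<close>\<close>
  u_min :: real
  u_max :: real
  v_min :: real
  v_max :: real
  t_init :: real               \<comment> \<open>\<open>t\<^sub>i\<^sup>0\<close>\<close>
  v_init :: real               \<comment> \<open>\<open>v\<^sub>i\<^sup>0\<close>\<close>
  terminal_times :: "real set" \<comment> \<open>allowed values of the terminal time; \<open>UNIV\<close> if it is free\<close>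
  lead_pos :: "real \<Rightarrow> real"    \<comment> \<open>position \<open>p\<^sub>k\<close> of the vehicle ahead\<close>
  headway :: real              \<comment> \<open>\<open>\<phi>\<close>\<close>
  standstill :: real           \<comment> \<open>\<open>\<delta>\<^sub>0\<close>\<close>
  lateral_time :: real         \<comment> \<open>the given time \<open>t\<^sub>1\<close>\<close>

text \<open>Only the values on \<open>[t\<^sub>i\<^sup>0, t\<^sub>i\<^sup>f]\<close> of the three functions matter.\<close>

record trajectory =
  pos :: "real \<Rightarrow> real"
  vel :: "real \<Rightarrow> real"
  ctrl :: "real \<Rightarrow> real"
  t_final :: real

definition dist_total :: "cav_problem \<Rightarrow> real" where
  "dist_total P = control_len P + merge_len P"

text \<open>The signs of \<open>u_min\<close> and \<open>u_max\<close> (full braking, full acceleration) are those for which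
  the terminal time bounds below make sense.\<close>

definition cav_parameters :: "cav_problem \<Rightarrow> bool" where
  "cav_parameters P \<longleftrightarrow>
     0 \<le> weight P \<and> 0 < control_len P \<and> 0 < merge_len P \<and>
     u_min P < 0 \<and> 0 < u_max P \<and>
     0 \<le> v_min P \<and> v_min P < v_init P \<and> v_init P < v_max P"

definition has_one_sided_limits :: "(real \<Rightarrow> real) \<Rightarrow> real \<Rightarrow> bool" where
  "has_one_sided_limits f t \<longleftrightarrow>
     (\<exists>l. (f \<longlongrightarrow> l) (at_left t)) \<and> (\<exists>l. (f \<longlongrightarrow> l) (at_right t))"

definition piecewise_continuous :: "real \<Rightarrow> real \<Rightarrow> (real \<Rightarrow> real) \<Rightarrow> bool" where
  "piecewise_continuous a b f \<longleftrightarrow>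
     finite {t \<in> {a<..<b}. \<not> isCont f t} \<and>
     (\<forall>t\<in>{a<..<b}. has_one_sided_limits f t) \<and>
     (\<exists>l. (f \<longlongrightarrow> l) (at_right a)) \<and> (\<exists>l. (f \<longlongrightarrow> l) (at_left b))"

definition dynamics :: "cav_problem \<Rightarrow> trajectory \<Rightarrow> bool" where
  "dynamics P x \<longleftrightarrow>
     t_init P < t_final x \<and>
     piecewise_continuous (t_init P) (t_final x) (ctrl x) \<and>
     continuous_on {t_init P..t_final x} (pos x) \<and>
     continuous_on {t_init P..t_final x} (vel x) \<and>
     (\<forall>t\<in>{t_init P<..<t_final x}. (pos x has_real_derivative vel x t) (at t)) \<and>
     finite {t \<in> {t_init P<..<t_final x}. \<not> (vel x has_real_derivative ctrl x t) (at t)} \<and>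
     pos x (t_init P) = 0 \<and> vel x (t_init P) = v_init P \<and>
     pos x (t_final x) = dist_total P"

text \<open>The lateral constraint refers to the position at time \<open>t\<^sub>1\<close>, which therefore has to lie
  in the time horizon.\<close>

definition feasible :: "cav_problem \<Rightarrow> trajectory \<Rightarrow> bool" where
  "feasible P x \<longleftrightarrow>
     dynamics P x \<and> t_final x \<in> terminal_times P \<and>
     (\<forall>t\<in>{t_init P..t_final x}.
        u_min P \<le> ctrl x t \<and> ctrl x t \<le> u_max P \<and>
        v_min P \<le> vel x t \<and> vel x t \<le> v_max P \<and>
        lead_pos P t - pos x t \<ge> headway P * vel x t + standstill P) \<and>
     lateral_time P \<in> {t_init P..t_final x} \<and> pos x (lateral_time P) \<le> control_len P"

definition cost :: "cav_problem \<Rightarrow> trajectory \<Rightarrow> real" where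
  "cost P x = integral {t_init P..t_final x} (\<lambda>t. weight P + 1/2 * (ctrl x t)\<^sup>2)"

definition optimal :: "cav_problem \<Rightarrow> trajectory \<Rightarrow> bool" where
  "optimal P x \<longleftrightarrow> feasible P x \<and> (\<forall>y. feasible P y \<longrightarrow> cost P x \<le> cost P y)"

text \<open>Every constraint except \<open>u \<le> u_max\<close> and \<open>v \<le> v_max\<close> is inactive.\<close>

definition others_inactive :: "cav_problem \<Rightarrow> trajectory \<Rightarrow> bool" where
  "others_inactive P x \<longleftrightarrow>
     (\<forall>t\<in>{t_init P..t_final x}.
        u_min P < ctrl x t \<and> v_min P < vel x t \<and>
        lead_pos P t - pos x t > headway P * vel x t + standstill P) \<and>
     pos x (lateral_time P) < control_len P"

definition t_lower :: "cav_problem \<Rightarrow> trajectory \<Rightarrow> real" where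
  "t_lower P x =
     (if vel x (t_final x) = v_max P
      then t_init P + dist_total P / v_max P + (v_max P - v_init P)\<^sup>2 / (2 * u_max P * v_max P)
      else t_init P + (sqrt (2 * dist_total P * u_max P + (v_init P)\<^sup>2) - v_init P) / u_max P)"

text \<open>The upper bound is \<open>\<infinity>\<close> where its closed formula has no real value: for \<open>v_min = 0\<close>
  in the first case, and, in the second, for a negative radicand (full braking stops the
  vehicle before it has travelled \<open>L + S\<close>).\<close>

definition t_upper :: "cav_problem \<Rightarrow> trajectory \<Rightarrow> ereal" where
  "t_upper P x =
     (if vel x (t_final x) = v_min P
      then if v_min P = 0 then \<infinity>
           else ereal (t_init P + dist_total P / v_min P
                       + (v_min P - v_init P)\<^sup>2 / (2 * u_min P * v_min P))
      else if 2 * dist_total P * u_min P + (v_init P)\<^sup>2 < 0 then \<infinity>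
           else ereal (t_init P
                       + (sqrt (2 * dist_total P * u_min P + (v_init P)\<^sup>2) - v_init P) / u_min P))"

text \<open>The costates \<open>\<lambda>\<^sup>p\<close>, \<open>\<lambda>\<^sup>v\<close> and the multipliers \<open>\<mu>\<^sup>a\<close>, \<open>\<mu>\<^sup>b\<close> are functions of time.\<close>

record multipliers =
  cost_p :: "real \<Rightarrow> real"
  cost_v :: "real \<Rightarrow> real"
  mu_a :: "real \<Rightarrow> real"
  mu_b :: "real \<Rightarrow> real"

definition hamiltonian :: "cav_problem \<Rightarrow> trajectory \<Rightarrow> multipliers \<Rightarrow> real \<Rightarrow> real" where
  "hamiltonian P x m t =
     weight P + 1/2 * (ctrl x t)\<^sup>2 + cost_p m t * vel x t + cost_v m t * ctrl x t"

text \<open>Which of the two constraints that may become active are active at time \<open>t\<close>. An arc is an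
  interval on which this is constant, and a junction is a time around which it is not constant
  (whatever it is at that very time).\<close>

definition active :: "cav_problem \<Rightarrow> trajectory \<Rightarrow> real \<Rightarrow> bool \<times> bool" where
  "active P x t = (ctrl x t = u_max P, vel x t = v_max P)"

definition junction :: "cav_problem \<Rightarrow> trajectory \<Rightarrow> real \<Rightarrow> bool" where
  "junction P x t \<longleftrightarrow>
     t \<in> {t_init P<..<t_final x} \<and> \<not> (\<exists>A. \<forall>\<^sub>F s in at t. active P x s = A)"

definition on_v_max_arc :: "cav_problem \<Rightarrow> trajectory \<Rightarrow> real \<Rightarrow> bool" where
  "on_v_max_arc P x t \<longleftrightarrow>
     t \<in> {t_init P<..<t_final x} \<and> (\<forall>\<^sub>F s in nhds t. vel x s = v_max P)"

definition enters_v_max_arc :: "cav_problem \<Rightarrow> trajectory \<Rightarrow> real \<Rightarrow> bool" where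
  "enters_v_max_arc P x \<tau> \<longleftrightarrow>
     \<tau> \<in> {t_init P<..<t_final x} \<and>
     (\<forall>\<^sub>F t in at_left \<tau>. vel x t < v_max P) \<and> (\<forall>\<^sub>F t in at_right \<tau>. vel x t = v_max P)"

definition stationary_at :: "cav_problem \<Rightarrow> trajectory \<Rightarrow> multipliers \<Rightarrow> real \<Rightarrow> bool" where
  "stationary_at P x m t \<longleftrightarrow>
     ctrl x t + cost_v m t + mu_a m t - mu_b m t = 0 \<and>
     0 \<le> mu_a m t \<and> (ctrl x t < u_max P \<longrightarrow> mu_a m t = 0) \<and>
     0 \<le> mu_b m t \<and> (ctrl x t > u_min P \<longrightarrow> mu_b m t = 0)"

definition jump_conditions :: "cav_problem \<Rightarrow> trajectory \<Rightarrow> multipliers \<Rightarrow> real \<Rightarrow> bool" where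
  "jump_conditions P x m \<tau> \<longleftrightarrow>
     (\<exists>\<pi>\<ge>0. \<pi> * (vel x \<tau> - v_max P) = 0 \<and>
        Lim (at_left \<tau>) (cost_p m) = Lim (at_right \<tau>) (cost_p m) \<and>
        Lim (at_left \<tau>) (cost_v m) = Lim (at_right \<tau>) (cost_v m) + \<pi> \<and>
        Lim (at_left \<tau>) (hamiltonian P x m) = Lim (at_right \<tau>) (hamiltonian P x m))"

text \<open>The pointwise conditions are allowed to fail at finitely many times, since the values of
  piecewise continuous functions at their discontinuities carry no information. The limits in
  the jump conditions exist because every entry time is a junction.\<close>

definition necessary_conditions :: "cav_problem \<Rightarrow> trajectory \<Rightarrow> multipliers \<Rightarrow> bool" where
  "necessary_conditions P x m \<longleftrightarrow>
     (\<forall>\<tau>. junction P x \<tau> \<longrightarrow>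
        (\<forall>f\<in>{ctrl x, cost_p m, cost_v m, mu_a m, mu_b m}. has_one_sided_limits f \<tau>)) \<and>
     finite {t \<in> {t_init P<..<t_final x}. \<not> stationary_at P x m t} \<and>
     finite {t. on_v_max_arc P x t \<and> ctrl x t \<noteq> 0} \<and>
     (\<forall>\<tau>. enters_v_max_arc P x \<tau> \<longrightarrow> jump_conditions P x m \<tau>)"

end

theory Submission
  imports Defs
begin

text \<open>Two computations of \<open>\<lambda>\<^sup>v(\<tau>\<^sup>-)\<close> at an entry time \<open>\<tau>\<close> contradict each other. The speed is
  continuous at \<open>\<tau>\<close> and \<open>\<lambda>\<^sup>p\<close> does not jump, so the terms \<open>\<gamma> + \<lambda>\<^sup>p v\<close> of the Hamiltonian have the
  same limits on both sides of \<open>\<tau>\<close>. On the speed arc the control vanishes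
  (\<open>ctrl_eventually_zero_after_entry\<close>), and with it the other terms. Continuity of the Hamiltonian
  therefore leaves \<open>u_max\<^sup>2 / 2 + \<lambda>\<^sup>v(\<tau>\<^sup>-) u_max = 0\<close>, that is, \<open>\<lambda>\<^sup>v(\<tau>\<^sup>-) = - u_max / 2\<close>.
  Stationarity on the control arc, however, gives \<open>\<lambda>\<^sup>v = - u_max - \<mu>\<^sup>a\<close> with \<open>\<mu>\<^sup>a \<ge> 0\<close>, so that
  \<open>\<lambda>\<^sup>v(\<tau>\<^sup>-) \<le> - u_max < - u_max / 2\<close> (\<open>cost_v_eventually_le_on_u_max_arc\<close>).\<close>

lemma eventually_off_finite_exceptions:
  fixes \<tau> :: "'a::t1_space"
  assumes "finite {t \<in> A. \<not> Q t}" and "\<forall>\<^sub>F t in at \<tau> within S. t \<in> A"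
  shows "\<forall>\<^sub>F t in at \<tau> within S. Q t"
proof -
  have "\<forall>\<^sub>F t in at \<tau> within S. \<forall>s\<in>{t \<in> A. \<not> Q t}. t \<noteq> s"
    by (intro eventually_ball_finite assms(1) ballI eventually_neq_at_within)
  then show ?thesis
    using assms(2) by eventually_elim blast
qed

lemma eventually_in_open_interval:
  fixes \<tau> :: real
  assumes "\<tau> \<in> {a<..<b}"
  shows "\<forall>\<^sub>F t in at \<tau> within S. t \<in> {a<..<b}"
proof -
  have "\<forall>\<^sub>F t in nhds \<tau>. t \<in> {a<..<b}"
    using assms by (intro eventually_nhds_in_open open_greaterThanLessThan)
  then show ?thesis
    by (auto simp: eventually_at_filter elim: eventually_mono)
qed

lemma vel_tendsto:
  assumes "dynamics P x" and "\<tau> \<in> {t_init P<..<t_final x}"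
  shows "(vel x \<longlongrightarrow> vel x \<tau>) (at \<tau> within S)"
proof -
  have "isCont (vel x) \<tau>"
    using assms by (auto simp: dynamics_def intro: continuous_on_interior)
  then show ?thesis
    by (simp add: continuous_within tendsto_within_subset[OF _ subset_UNIV])
qed

text \<open>On the speed arc \<open>u = 0\<close> is known only in the interior of the arc and up to finitely many
  exceptions. Every time just after \<open>\<tau>\<close> is interior to the arc, although \<open>\<tau>\<close> is not, and the
  exceptions stay away from \<open>\<tau>\<close>; so the right limit of \<open>u\<close> at \<open>\<tau>\<close> is \<open>0\<close>.\<close>

lemma ctrl_eventually_zero_after_entry:
  assumes "necessary_conditions P x m" and \<tau>: "\<tau> \<in> {t_init P<..<t_final x}"
    and arc: "\<forall>\<^sub>F t in at_right \<tau>. vel x t = v_max P"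
  shows "\<forall>\<^sub>F t in at_right \<tau>. ctrl x t = 0"
proof -
  obtain b where b: "b > \<tau>" "\<And>t. \<tau> < t \<Longrightarrow> t < b \<Longrightarrow> vel x t = v_max P"
    using arc unfolding eventually_at_right_field by blast
  have "\<forall>\<^sub>F t in at_right \<tau>. t \<in> {\<tau><..<b}"
    using b(1) by (rule eventually_at_right_real)
  then have "\<forall>\<^sub>F t in at_right \<tau>. t \<in> {t. on_v_max_arc P x t}"
    using eventually_in_open_interval[OF \<tau>]
  proof eventually_elim
    case (elim t)
    have "\<forall>\<^sub>F s in nhds t. s \<in> {\<tau><..<b}"
      using elim(1) by (intro eventually_nhds_in_open open_greaterThanLessThan)
    then have "\<forall>\<^sub>F s in nhds t. vel x s = v_max P"
      by eventually_elim (use b(2) in auto)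
    then show ?case
      using elim(2) by (simp add: on_v_max_arc_def)
  qed
  moreover have "finite {t \<in> {t. on_v_max_arc P x t}. \<not> ctrl x t = 0}"
    using assms(1) by (simp add: necessary_conditions_def)
  ultimately show ?thesis
    by (rule eventually_off_finite_exceptions[rotated])
qed

text \<open>Where \<open>u = u_max > u_min\<close>, stationarity reads \<open>\<lambda>\<^sup>v = - u_max - \<mu>\<^sup>a\<close>: the multiplier
  \<open>\<mu>\<^sup>a \<ge> 0\<close> can only push \<open>\<lambda>\<^sup>v\<close> below the value \<open>- u\<close> that it has on an unconstrained arc.\<close>

lemma cost_v_eventually_le_on_u_max_arc:
  assumes "necessary_conditions P x m" and "u_min P < u_max P"
    and \<tau>: "\<tau> \<in> {t_init P<..<t_final x}"
    and arc: "\<forall>\<^sub>F t in at \<tau> within S. ctrl x t = u_max P"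
  shows "\<forall>\<^sub>F t in at \<tau> within S. cost_v m t \<le> - u_max P"
proof -
  have "finite {t \<in> {t_init P<..<t_final x}. \<not> stationary_at P x m t}"
    using assms(1) by (simp add: necessary_conditions_def)
  then have "\<forall>\<^sub>F t in at \<tau> within S. stationary_at P x m t"
    using eventually_in_open_interval[OF \<tau>] by (rule eventually_off_finite_exceptions)
  then show ?thesis
    using arc by eventually_elim (use assms(2) in \<open>auto simp: stationary_at_def\<close>)
qed

text \<open>The jump conditions are phrased with \<^const>\<open>Lim\<close>, so they say something only once the
  one-sided limits are known to exist; this is what being a junction provides.\<close>

lemma entry_time_is_junction:
  assumes "enters_v_max_arc P x \<tau>"
  shows "junction P x \<tau>"
proof -
  have False if "\<forall>\<^sub>F s in at \<tau>. active P x s = A" for A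
  proof -
    have left: "\<forall>\<^sub>F s in at_left \<tau>. active P x s = A"
      and right: "\<forall>\<^sub>F s in at_right \<tau>. active P x s = A"
      using that by (simp_all add: eventually_at_split)
    have vl: "\<forall>\<^sub>F s in at_left \<tau>. vel x s < v_max P"
      and vr: "\<forall>\<^sub>F s in at_right \<tau>. vel x s = v_max P"
      using assms by (simp_all add: enters_v_max_arc_def)
    from left vl have "\<forall>\<^sub>F s in at_left \<tau>. \<not> snd A"
      by eventually_elim (auto simp: active_def)
    moreover from right vr have "\<forall>\<^sub>F s in at_right \<tau>. snd A"
      by eventually_elim (auto simp: active_def)
    ultimately show False
      by simp
  qed
  then show ?thesis
    using assms by (auto simp: junction_def enters_v_max_arc_def)
qed

lemma hamiltonian_tendsto:
  assumes "(vel x \<longlongrightarrow> v) F" and "(cost_p m \<longlongrightarrow> lp) F" and "(cost_v m \<longlongrightarrow> lv) F"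
    and "\<forall>\<^sub>F t in F. ctrl x t = u"
  shows "(hamiltonian P x m \<longlongrightarrow> weight P + 1/2 * u\<^sup>2 + lp * v + lv * u) F"
proof -
  have "(ctrl x \<longlongrightarrow> u) F"
    using assms(4) by (rule tendsto_eventually)
  then show ?thesis
    unfolding hamiltonian_def by (intro tendsto_intros assms)
qed

theorem theorem4:
  fixes P :: cav_problem and x :: trajectory and m :: multipliers
  assumes "cav_parameters P"
    and "optimal P x"
    and "others_inactive P x"
    and "necessary_conditions P x m"
    and "t_lower P x < t_final x"
    and "ereal (t_final x) < t_upper P x"
  shows "\<not> (\<exists>\<tau>\<in>{t_init P<..<t_final x}.
              (\<forall>\<^sub>F t in at_left \<tau>. ctrl x t = u_max P \<and> vel x t < v_max P) \<and>
              (\<forall>\<^sub>F t in at_right \<tau>. vel x t = v_max P))"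
proof
  assume "\<exists>\<tau>\<in>{t_init P<..<t_final x}.
              (\<forall>\<^sub>F t in at_left \<tau>. ctrl x t = u_max P \<and> vel x t < v_max P) \<and>
              (\<forall>\<^sub>F t in at_right \<tau>. vel x t = v_max P)"
  then obtain \<tau> where \<tau>: "\<tau> \<in> {t_init P<..<t_final x}"
    and ul: "\<forall>\<^sub>F t in at_left \<tau>. ctrl x t = u_max P"
    and vl: "\<forall>\<^sub>F t in at_left \<tau>. vel x t < v_max P"
    and vr: "\<forall>\<^sub>F t in at_right \<tau>. vel x t = v_max P"
    by (auto simp: eventually_conj_iff)
  have u: "u_min P < u_max P" "0 < u_max P"
    using assms(1) by (auto simp: cav_parameters_def)
  have dyn: "dynamics P x"
    using assms(2) by (simp add: optimal_def feasible_def)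
  have entry: "enters_v_max_arc P x \<tau>"
    using \<tau> vl vr by (simp add: enters_v_max_arc_def)
  obtain lpl lpr lvl lvr where
    lpl: "(cost_p m \<longlongrightarrow> lpl) (at_left \<tau>)" and lpr: "(cost_p m \<longlongrightarrow> lpr) (at_right \<tau>)" and
    lvl: "(cost_v m \<longlongrightarrow> lvl) (at_left \<tau>)" and lvr: "(cost_v m \<longlongrightarrow> lvr) (at_right \<tau>)"
    using assms(4) entry_time_is_junction[OF entry]
    unfolding necessary_conditions_def has_one_sided_limits_def by auto
  have "jump_conditions P x m \<tau>"
    using assms(4) entry by (simp add: necessary_conditions_def)
  then have jump: "Lim (at_left \<tau>) (cost_p m) = Lim (at_right \<tau>) (cost_p m)"
    "Lim (at_left \<tau>) (hamiltonian P x m) = Lim (at_right \<tau>) (hamiltonian P x m)"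
    by (auto simp: jump_conditions_def)
  have "Lim (at_left \<tau>) (hamiltonian P x m)
      = weight P + 1/2 * (u_max P)\<^sup>2 + lpl * vel x \<tau> + lvl * u_max P"
    using hamiltonian_tendsto[OF vel_tendsto[OF dyn \<tau>] lpl lvl ul]
    by (intro tendsto_Lim) simp_all
  moreover have "Lim (at_right \<tau>) (hamiltonian P x m)
      = weight P + 1/2 * 0\<^sup>2 + lpr * vel x \<tau> + lvr * 0"
    using hamiltonian_tendsto[OF vel_tendsto[OF dyn \<tau>] lpr lvr
        ctrl_eventually_zero_after_entry[OF assms(4) \<tau> vr]]
    by (intro tendsto_Lim) simp_all
  moreover have "lpl = lpr"
    using jump(1) lpl lpr by (simp add: tendsto_Lim)
  ultimately have "u_max P * (u_max P / 2 + lvl) = 0"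
    using jump(2) by (simp add: power2_eq_square algebra_simps)
  then have "lvl = - u_max P / 2"
    using u(2) by simp
  moreover have "lvl \<le> - u_max P"
    using cost_v_eventually_le_on_u_max_arc[OF assms(4) u(1) \<tau> ul]
    by (intro tendsto_upperbound[OF lvl]) simp_all
  ultimately show False
    using u(2) by simp
qed

end
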